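(* Let $N\ge 2$, $N_\theta$ and $2\le N_{\mathrm{KL}}\le N_\theta-1$ be integers, let $\sigma^\ast,\ell^\ast>0$ be the true covariance parameters, and put $x_j=j^2$, $$\lambda_j^{\mathrm{mod}}(\sigma^\ast,\ell^\ast)=\sqrt\pi\,{\sigma^\ast}^2\ell^\ast e^{-{\ell^\ast}^2j^2/4},\qquad A^\ast=\log\!\big(\sqrt\pi\,{\sigma^\ast}^2\ell^\ast\big),\qquad B^\ast=\frac{{\ell^\ast}^2}{4},$$ so that $y_j^\ast:=\log\lambda_j^{\mathrm{mod}}(\sigma^\ast,\ell^\ast)=A^\ast-B^\ast x_j$ for $j=0,\dots,N_{\mathrm{KL}}$. Let $x^{(s)},\widehat x^{(s)}\in\mathbb{R}^{N_\theta}$, $s=1,\dots,N$, be the true and reconstructed discretised fluctuations, let $\widehat\lambda_j^{\mathrm{rec}}$ be the rescaled eigenvalues of the reconstructed empirical covariance matrix, and let $E_\lambda$ be the total eigenvalue error bound (both defined in the context). Assume: (a) there exist constants $M_x>0$, $\varepsilon>0$ with $\frac1N\sum_{s=1}^N\|x^{(s)}\|_2^2\le M_x$ and $\frac1N\sum_{s=1}^N\|\widehat x^{(s)}-x^{(s)}\|_2^2\le\varepsilon^2$; (b) there exists a constant $c_0>0$ such that $\lambda_j^{\mathrm{mod}}(\sigma^\ast,\ell^\ast)\ge c_0$ for all $j=0,\dots,N_{\mathrm{KL}}$; the errors satisfy $|\widehat\lambda_j^{\mathrm{rec}}-\lambda_j^{\mathrm{mod}}(\sigma^\ast,\ell^\ast)|\le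 E_\lambda$ for all $j=0,\dots,N_{\mathrm{KL}}$; and $E_\lambda\le c_0/2$. Let $y_j=\log\widehat\lambda_j^{\mathrm{rec}}$ and let $$(A_{\mathrm{fit}},B_{\mathrm{fit}})=\arg\min_{A,B}\ \sum_{j=0}^{N_{\mathrm{KL}}}\big(y_j-(A-Bx_j)\big)^2 .$$ Then there exists a constant $C_1=C_1(N_{\mathrm{KL}},\{x_j\}_{j=0}^{N_{\mathrm{KL}}})>0$, depending only on $N_{\mathrm{KL}}$ and $\{x_j\}_{j=0}^{N_{\mathrm{KL}}}$, such that $$|A_{\mathrm{fit}}-A^\ast|+|B_{\mathrm{fit}}-B^\ast|\le C_1E_\lambda .$$ Moreover, let $$\ell_{\mathrm{est}}=\sqrt{\max\{4B_{\mathrm{fit}},0\}},\qquad \sigma_{\mathrm{est}}=\sqrt{\frac{e^{A_{\mathrm{fit}}}}{\sqrt\pi\,\ell_{\mathrm{est}}}} .$$ If the true covariance parameters $(\sigma^\ast,\ell^\ast)$ are contained in a compact set $I\subset(0,\infty)^2$ and $(A_{\mathrm{fit}},B_{\mathrm{fit}})$ also lies in some bounded set $I_{AB}:=\{(A,B):\|(A,B)\|<\infty,\ B>0\}$, then there exists $C_2>0$ (depending on these sets $I$ and $I_{AB}$, which are referred to as compact sets) such that $$|\sigma_{\mathrm{est}}-\sigma^\ast|+|\ell_{\mathrm{est}}-\ell^\ast|\le C_2\big(|A_{\mathrm{fit}}-A^\ast|+|B_{\mathrm{fit}}-B^\ast|\big)\le C_1C_2E_\lambda .$$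
   Context: The true and reconstructed empirical covariance matrices are $\widehat\Sigma_N=\frac1{N-1}\sum_{s=1}^N x^{(s)}x^{(s)\top}$ and $\widehat\Sigma_N^{\mathrm{rec}}=\frac1{N-1}\sum_{s=1}^N\widehat x^{(s)}\widehat x^{(s)\top}$, both in $\mathbb{R}^{N_\theta\times N_\theta}$, where $N$ is the number of samples and $N_\theta$ the number of grid points on the scatterer boundary. Their eigenvalues, indexed correspondingly by $j=0,\dots,N_\theta-1$, are $\widehat\mu_j$ and $\widehat\mu_j^{\mathrm{rec}}$, and with the quadrature weight $w=2\pi/N_\theta$ one sets $\widehat\lambda_j=w\,\widehat\mu_j$ and $\widehat\lambda_j^{\mathrm{rec}}=w\,\widehat\mu_j^{\mathrm{rec}}$. The parameters $(\sigma^\ast,\ell^\ast)$ are the true standard deviation and correlation length. $N_{\mathrm{KL}}$ is the fixed number of selected Karhunen–Loève modes. The total error bound is $E_\lambda:=E_{\mathrm{eig}}+E_{\mathrm{mod}}$, where $E_{\mathrm{eig}}=w\,\frac{N}{N-1}\big(2\sqrt{M_x}\,\varepsilon+\varepsilon^2\big)$ bounds $|\widehat\lambda_j^{\mathrm{rec}}-\widehat\lambda_j|$, and $E_{\mathrm{mod}}>0$ is a finite modelling error (the sum of quadrature, asymptotic-approximation and finite-sample error bounds) with $|\widehat\lambda_j-\lambda_j^{\mathrm{mod}}(\sigma^\ast,\ell^\ast)|\le E_{\mathrm{mod}}$ for $j=0,\dots,N_{\mathrm{KL}}$.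
   Formalization: The constant C_1 depends on N_KL and also on the lower bound c_0 (no constant independent of c_0 exists: let σ* tend to 0), and I_AB is a compact subset of R×(0,∞), since for merely bounded I_AB σ_est blows up as B_fit tends to 0. *)

theory Defs
  imports "HOL-Analysis.Analysis" "HOL-Combinatorics.Permutations"
    "Jordan_Normal_Form.Char_Poly"
begin

text \<open>
  Matrices and vectors use the carrier-based types of Jordan_Normal_Form, so that the number of
  grid points is an ordinary natural number and constants can be chosen uniformly in it.
  Samples are indexed by \<open>s \<in> {1..N}\<close>.
\<close>

definition emp_cov :: "nat \<Rightarrow> nat \<Rightarrow> (nat \<Rightarrow> real vec) \<Rightarrow> real mat" where
  "emp_cov N n x = mat n n (\<lambda>(i, k). (\<Sum>s=1..N. x s $ i * x s $ k) / (real N - 1))"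

text \<open>\<open>\<mu> 0, \<dots>, \<mu> (n - 1)\<close> lists the eigenvalues of an \<open>n \<times> n\<close> matrix with algebraic multiplicity,
  in no particular order.\<close>

definition enumerates_eigenvalues :: "real mat \<Rightarrow> (nat \<Rightarrow> real) \<Rightarrow> bool" where
  "enumerates_eigenvalues A \<mu> \<longleftrightarrow> char_poly A = (\<Prod>j<dim_row A. [:- \<mu> j, 1:])"

text \<open>
  Two enumerations are indexed correspondingly if the \<open>k\<close>-th largest entry of one always carries
  the same index as the \<open>k\<close>-th largest entry of the other (the pairing of Weyl's perturbation
  inequality).  The common labelling itself is free: it may be the decreasing order (take \<open>p = id\<close>)
  or, for instance, a Fourier mode number.
\<close>

definition corresponding :: "nat \<Rightarrow> (nat \<Rightarrow> real) \<Rightarrow> (nat \<Rightarrow> real) \<Rightarrow> bool" where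
  "corresponding n \<mu> \<nu> \<longleftrightarrow>
    (\<exists>p. p permutes {..<n} \<and> antimono_on {..<n} (\<mu> \<circ> p) \<and> antimono_on {..<n} (\<nu> \<circ> p))"

definition quad_weight :: "nat \<Rightarrow> real" where
  "quad_weight n = 2 * pi / real n"

definition lambda_mod :: "real \<Rightarrow> real \<Rightarrow> nat \<Rightarrow> real" where
  "lambda_mod \<sigma> l j = sqrt pi * \<sigma>\<^sup>2 * l * exp (- (l\<^sup>2 * (real j)\<^sup>2 / 4))"

definition A_true :: "real \<Rightarrow> real \<Rightarrow> real" where
  "A_true \<sigma> l = ln (sqrt pi * \<sigma>\<^sup>2 * l)"

definition B_true :: "real \<Rightarrow> real" where
  "B_true l = l\<^sup>2 / 4"

definition E_eig :: "nat \<Rightarrow> nat \<Rightarrow> real \<Rightarrow> real \<Rightarrow> real" where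
  "E_eig N n M \<epsilon> = quad_weight n * (real N / (real N - 1)) * (2 * sqrt M * \<epsilon> + \<epsilon>\<^sup>2)"

definition node :: "nat \<Rightarrow> real" where
  "node j = (real j)\<^sup>2"

definition lsq :: "nat \<Rightarrow> (nat \<Rightarrow> real) \<Rightarrow> real \<times> real \<Rightarrow> real" where
  "lsq K y = (\<lambda>(A, B). \<Sum>j=0..K. (y j - (A - B * node j))\<^sup>2)"

definition l_est :: "real \<Rightarrow> real" where
  "l_est B = sqrt (max (4 * B) 0)"

definition sigma_est :: "real \<Rightarrow> real \<Rightarrow> real" where
  "sigma_est A B = sqrt (exp A / (sqrt pi * l_est B))"

text \<open>
  Two remarks on the constants of the parameter estimate.  The first constant depends on the number
  of modes and on the lower bound \<open>c\<^sub>0\<close> of the model eigenvalues: the logarithm has Lipschitz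
  constant of order \<open>1 / c\<^sub>0\<close> there, so no constant is uniform in \<open>c\<^sub>0\<close>.  The second one depends on
  compact subsets of the two open parameter domains; boundedness of the set of fitted pairs is not
  sufficient, since \<open>sigma_est A B\<close> is unbounded as \<open>B\<close> tends to \<open>0\<close> from above.
\<close>

end

theory Submission
  imports Defs
begin

text \<open>
  Taking logarithms turns the model eigenvalues into exact values of the affine function
  \<open>A - B x\<close> at the nodes, so the fit recovers the true pair up to the error of its data.
  All eigenvalues involved are at least \<open>c\<^sub>0 / 2\<close>, where the logarithm has Lipschitz constant
  \<open>2 / c\<^sub>0\<close>; hence the data are off by at most \<open>2 E / c\<^sub>0\<close> at every node
  (\<open>abs_ln_diff_le\<close>).

  Stability of the fit needs no normal equations (\<open>lsq_minimiser_stable\<close>).  A minimiser does at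
  least as well as the true pair, whose residuals are exactly the data errors, so the residual sum
  of squares of the minimiser controls the deviation of the two affine functions at each node.
  Two nodes determine an affine function, and the nodes \<open>0\<close> and \<open>1\<close> already give explicit
  constants.

  The parameter map \<open>(A, B) \<mapsto> (sigma_est A B, l_est B)\<close> inverts
  \<open>(\<sigma>, l) \<mapsto> (A_true \<sigma> l, B_true l)\<close>.  On compact subsets of the open domains, \<open>B\<close> and \<open>l\<close> stay
  away from \<open>0\<close> and the standard deviations stay bounded, which makes the square root
  and \<open>ln (sigma_est A B) = A / 2 - ln B / 4 + const\<close> Lipschitz; no segment joining the two
  points, and hence no convex hull of the two sets, has to be considered
  (\<open>parameter_map_lipschitz\<close>).
\<close>

section \<open>Stability of the logarithmic least-squares fit\<close>

lemma abs_ln_diff_le: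
  fixes a b m :: real
  assumes "0 < m" "m \<le> a" "m \<le> b"
  shows "\<bar>ln a - ln b\<bar> \<le> \<bar>a - b\<bar> / m"
proof -
  have *: "ln u - ln v \<le> \<bar>u - v\<bar> / m" if "m \<le> u" "m \<le> v" for u v :: real
  proof -
    have "ln u - ln v \<le> (u - v) / v"
      using ln_diff_le[of u v] that assms(1) by simp
    also have "\<dots> \<le> \<bar>u - v\<bar> / m"
      using that assms(1) by (intro frac_le) auto
    finally show ?thesis .
  qed
  show ?thesis
    using *[of a b] *[of b a] assms by (simp add: abs_le_iff abs_minus_commute)
qed

text \<open>The exponential is Lipschitz on half-lines bounded above, written in terms of its values.\<close>

lemma abs_diff_le_abs_ln_diff:
  fixes a b S :: real
  assumes "0 < a" "a \<le> S" "0 < b" "b \<le> S"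
  shows "\<bar>a - b\<bar> \<le> S * \<bar>ln a - ln b\<bar>"
proof -
  have *: "u - v \<le> S * \<bar>ln u - ln v\<bar>" if "0 < u" "u \<le> S" "0 < v" for u v :: real
  proof -
    have "(ln v - ln u) * u \<le> v - u"
      using ln_diff_le[of v u] that by (simp only: pos_le_divide_eq)
    then have "u - v \<le> u * (ln u - ln v)"
      unfolding right_diff_distrib left_diff_distrib by (simp add: mult.commute)
    also have "\<dots> \<le> u * \<bar>ln u - ln v\<bar>"
      using that by (intro mult_left_mono) auto
    also have "\<dots> \<le> S * \<bar>ln u - ln v\<bar>"
      using that by (intro mult_right_mono) auto
    finally show ?thesis .
  qed
  show ?thesis
    using *[of a b] *[of b a] assms by (simp add: abs_le_iff abs_minus_commute)
qed

text \<open>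
  The true pair has residual sum of squares at most \<open>(K + 1) \<delta>\<^sup>2\<close>, hence so has the minimiser, and
  each of its residuals is at most \<open>sqrt (K + 1) \<delta>\<close>.  The difference of the two affine functions is
  therefore at most \<open>(1 + sqrt (K + 1)) \<delta>\<close> at every node: at the node \<open>0\<close> this bounds the
  intercept, and subtracting the values at \<open>0\<close> and \<open>1\<close> bounds the slope.
\<close>

lemma lsq_minimiser_stable:
  assumes "1 \<le> K"
    and data: "\<And>j. j \<le> K \<Longrightarrow> \<bar>y j - (A - B * node j)\<bar> \<le> \<delta>"
    and min: "is_arg_min (lsq K y) (\<lambda>_. True) (A', B')"
  shows "\<bar>A' - A\<bar> + \<bar>B' - B\<bar> \<le> 3 * (1 + sqrt (real K + 1)) * \<delta>"
proof -
  have "0 \<le> \<delta>"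
    using data[of 0] by linarith
  have "lsq K y (A', B') \<le> lsq K y (A, B)"
    using min by (auto simp: is_arg_min_def not_less)
  also have "\<dots> \<le> (\<Sum>j=0..K. \<delta>\<^sup>2)"
    unfolding lsq_def prod.case
    using data by (intro sum_mono) (metis abs_le_square_iff abs_of_nonneg \<open>0 \<le> \<delta>\<close> atLeastAtMost_iff)
  also have "\<dots> = (sqrt (real K + 1) * \<delta>)\<^sup>2"
    by (simp add: power_mult_distrib algebra_simps)
  finally have rss: "(\<Sum>j=0..K. (y j - (A' - B' * node j))\<^sup>2) \<le> (sqrt (real K + 1) * \<delta>)\<^sup>2"
    by (simp add: lsq_def)
  have node_dev: "\<bar>(A' - A) - (B' - B) * node j\<bar> \<le> (1 + sqrt (real K + 1)) * \<delta>" if "j \<le> K" for j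
  proof -
    have "(y j - (A' - B' * node j))\<^sup>2 \<le> (\<Sum>j=0..K. (y j - (A' - B' * node j))\<^sup>2)"
      using that by (intro member_le_sum[of j "{0..K}" "\<lambda>j. (y j - (A' - B' * node j))\<^sup>2"]) auto
    then have "\<bar>y j - (A' - B' * node j)\<bar> \<le> \<bar>sqrt (real K + 1) * \<delta>\<bar>"
      unfolding abs_le_square_iff using rss by linarith
    then have "\<bar>y j - (A' - B' * node j)\<bar> \<le> sqrt (real K + 1) * \<delta>"
      using \<open>0 \<le> \<delta>\<close> by (simp only: abs_of_nonneg mult_nonneg_nonneg real_sqrt_ge_zero)
    with data[OF that] show ?thesis
      unfolding left_diff_distrib distrib_right by linarith
  qed
  have "\<bar>A' - A\<bar> \<le> (1 + sqrt (real K + 1)) * \<delta>"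
    using node_dev[of 0] by (simp add: node_def)
  moreover have "\<bar>(A' - A) - (B' - B)\<bar> \<le> (1 + sqrt (real K + 1)) * \<delta>"
    using node_dev[of 1] assms(1) by (simp add: node_def)
  ultimately show ?thesis
    by linarith
qed

lemma ln_lambda_mod:
  assumes "0 < \<sigma>" "0 < l"
  shows "ln (lambda_mod \<sigma> l j) = A_true \<sigma> l - B_true l * node j"
  using assms unfolding lambda_mod_def A_true_def B_true_def node_def
  by (subst ln_mult) simp_all

section \<open>The parameter map on compact sets\<close>

lemma ln_sigma_est:
  assumes "0 < B"
  shows "ln (sigma_est A B) = A / 2 - ln B / 4 - ln (2 * sqrt pi) / 2"
proof -
  have "l_est B = 2 * sqrt B"
    using assms by (simp add: l_est_def real_sqrt_mult)
  then have "ln (sigma_est A B) = ln (exp A / (2 * sqrt pi * sqrt B)) / 2"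
    using assms by (simp add: sigma_est_def ln_sqrt mult_ac)
  also have "\<dots> = (A - (ln (2 * sqrt pi) + ln (sqrt B))) / 2"
    using assms by (subst ln_div, simp, simp, subst ln_mult) simp_all
  also have "ln (sqrt B) = ln B / 2"
    using assms by (simp add: ln_sqrt)
  finally show ?thesis
    by (simp add: diff_divide_distrib add_divide_distrib)
qed

lemma sigma_est_pos: "0 < B \<Longrightarrow> 0 < sigma_est A B"
  by (simp add: sigma_est_def l_est_def)

lemma l_est_B_true: "0 < l \<Longrightarrow> l_est (B_true l) = l"
  by (simp add: l_est_def B_true_def)

lemma sigma_est_true:
  assumes "0 < \<sigma>" "0 < l"
  shows "sigma_est (A_true \<sigma> l) (B_true l) = \<sigma>"
  using assms by (simp add: sigma_est_def l_est_B_true A_true_def)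

lemma compact_positive_bounds:
  fixes f :: "'a::topological_space \<Rightarrow> real"
  assumes "compact S" "continuous_on S f" "\<And>p. p \<in> S \<Longrightarrow> 0 < f p"
  obtains m M where "0 < m" "0 < M" "\<And>p. p \<in> S \<Longrightarrow> m \<le> f p \<and> f p \<le> M"
proof (cases "S = {}")
  case True
  then show thesis
    using that[of 1 1] by simp
next
  case False
  obtain p where "p \<in> S" "\<forall>q\<in>S. f p \<le> f q"
    using continuous_attains_inf[OF assms(1) False assms(2)] by blast
  moreover obtain r where "r \<in> S" "\<forall>q\<in>S. f q \<le> f r"
    using continuous_attains_sup[OF assms(1) False assms(2)] by blast
  ultimately show thesis
    using that[of "f p" "f r"] assms(3) by auto
qed

text \<open>
  Quantitative form of the estimate: the lower bound \<open>m\<close> controls \<open>ln B\<close> and the square root in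
  \<open>l_est\<close>, the upper bound \<open>S\<close> controls the exponential that leads from \<open>ln \<sigma>\<close> back to \<open>\<sigma>\<close>.
\<close>

lemma parameter_map_estimate:
  assumes "0 < \<sigma>" "\<sigma> \<le> S" "sigma_est A B \<le> S"
    and "0 < m" "m \<le> l" "m \<le> B" "m \<le> B_true l"
  shows "\<bar>sigma_est A B - \<sigma>\<bar> + \<bar>l_est B - l\<bar>
    \<le> (S * (1 / 2 + 1 / (4 * m)) + 4 / m) * (\<bar>A - A_true \<sigma> l\<bar> + \<bar>B - B_true l\<bar>)"
proof -
  define a where "a = \<bar>A - A_true \<sigma> l\<bar>"
  define b where "b = \<bar>B - B_true l\<bar>"
  have "0 \<le> a" "0 \<le> b" "0 < B" "0 < l" "0 < B_true l" "0 < S"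
    using assms by (auto simp: a_def b_def)
  have ln_diff: "ln (sigma_est A B) - ln \<sigma> = (A - A_true \<sigma> l) / 2 - (ln B - ln (B_true l)) / 4"
    using ln_sigma_est[OF \<open>0 < B\<close>, of A] ln_sigma_est[OF \<open>0 < B_true l\<close>, of "A_true \<sigma> l"]
      sigma_est_true[OF \<open>0 < \<sigma>\<close> \<open>0 < l\<close>] by (simp add: field_simps)
  have "\<bar>ln (sigma_est A B) - ln \<sigma>\<bar> \<le> \<bar>(A - A_true \<sigma> l) / 2\<bar> + \<bar>(ln B - ln (B_true l)) / 4\<bar>"
    unfolding ln_diff by (rule abs_triangle_ineq4)
  also have "\<dots> = a / 2 + \<bar>ln B - ln (B_true l)\<bar> / 4"
    by (simp add: a_def)
  also have "\<dots> \<le> a / 2 + (b / m) / 4"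
    using abs_ln_diff_le[OF \<open>0 < m\<close> \<open>m \<le> B\<close> \<open>m \<le> B_true l\<close>] unfolding b_def by simp
  also have "\<dots> \<le> (1 / 2 + 1 / (4 * m)) * (a + b)"
  proof -
    have 1: "a / 2 \<le> 1 / 2 * (a + b)"
      using \<open>0 \<le> b\<close> by simp
    have 2: "(b / m) / 4 \<le> 1 / (4 * m) * (a + b)"
      using divide_right_mono[of b "a + b" "4 * m"] \<open>0 \<le> a\<close> \<open>0 < m\<close> by (simp add: mult.commute)
    show ?thesis
      unfolding distrib_right[of "1 / 2" _ "a + b"] by (rule add_mono[OF 1 2])
  qed
  finally have "S * \<bar>ln (sigma_est A B) - ln \<sigma>\<bar> \<le> S * ((1 / 2 + 1 / (4 * m)) * (a + b))"
    using \<open>0 < S\<close> by simp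
  then have \<sigma>: "\<bar>sigma_est A B - \<sigma>\<bar> \<le> S * ((1 / 2 + 1 / (4 * m)) * (a + b))"
    using abs_diff_le_abs_ln_diff[of "sigma_est A B" S \<sigma>] sigma_est_pos[OF \<open>0 < B\<close>, of A] assms
    by linarith
  \<comment> \<open>Divide the factorisation of \<open>(l_est B)\<^sup>2 - l\<^sup>2\<close> by the sum of the roots.\<close>
  have "0 \<le> l_est B" "(l_est B)\<^sup>2 = 4 * B"
    using \<open>0 < B\<close> by (auto simp: l_est_def)
  then have "(l_est B - l) * (l_est B + l) = 4 * (B - B_true l)"
    by (simp add: B_true_def algebra_simps power2_eq_square)
  then have "\<bar>l_est B - l\<bar> * \<bar>l_est B + l\<bar> = 4 * b"
    unfolding abs_mult[symmetric] b_def by (simp only: abs_mult abs_numeral)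
  moreover have "\<bar>l_est B - l\<bar> * m \<le> \<bar>l_est B - l\<bar> * \<bar>l_est B + l\<bar>"
    using \<open>0 \<le> l_est B\<close> \<open>m \<le> l\<close> by (intro mult_left_mono) auto
  ultimately have "\<bar>l_est B - l\<bar> \<le> 4 / m * b"
    using \<open>0 < m\<close> by (simp add: field_simps)
  also have "\<dots> \<le> 4 / m * (a + b)"
    using \<open>0 \<le> a\<close> \<open>0 < m\<close> by (intro mult_left_mono) auto
  finally show ?thesis
    using \<sigma> unfolding a_def[symmetric] b_def[symmetric] by (simp add: algebra_simps)
qed

lemma parameter_map_lipschitz:
  assumes "compact I" "I \<subseteq> {0<..} \<times> {0<..}" "compact J" "J \<subseteq> UNIV \<times> {0<..}"
  shows "\<exists>C>0. \<forall>\<sigma> l A B. (\<sigma>, l) \<in> I \<and> (A, B) \<in> J \<longrightarrow>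
    \<bar>sigma_est A B - \<sigma>\<bar> + \<bar>l_est B - l\<bar> \<le> C * (\<bar>A - A_true \<sigma> l\<bar> + \<bar>B - B_true l\<bar>)"
proof -
  have I_pos: "0 < fst p" "0 < snd p" if "p \<in> I" for p
    using assms(2) that by auto
  have J_pos: "0 < snd p" if "p \<in> J" for p
    using assms(4) that by auto
  obtain m\<^sub>1 M\<^sub>1 where 1: "0 < m\<^sub>1" "0 < M\<^sub>1" "\<And>p. p \<in> I \<Longrightarrow> m\<^sub>1 \<le> fst p \<and> fst p \<le> M\<^sub>1"
    by (rule compact_positive_bounds[OF assms(1), of fst]) (simp_all add: continuous_on_fst continuous_on_snd I_pos)
  obtain m\<^sub>2 M\<^sub>2 where 2: "0 < m\<^sub>2" "0 < M\<^sub>2" "\<And>p. p \<in> I \<Longrightarrow> m\<^sub>2 \<le> snd p \<and> snd p \<le> M\<^sub>2"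
    by (rule compact_positive_bounds[OF assms(1), of snd]) (simp_all add: continuous_on_fst continuous_on_snd I_pos)
  obtain m\<^sub>3 M\<^sub>3 where 3: "0 < m\<^sub>3" "0 < M\<^sub>3" "\<And>p. p \<in> J \<Longrightarrow> m\<^sub>3 \<le> snd p \<and> snd p \<le> M\<^sub>3"
    by (rule compact_positive_bounds[OF assms(3), of snd]) (simp_all add: continuous_on_fst continuous_on_snd J_pos)
  have "continuous_on J (\<lambda>p. sigma_est (fst p) (snd p))"
    unfolding sigma_est_def l_est_def using J_pos by (intro continuous_intros) fastforce+
  then obtain m\<^sub>4 M\<^sub>4 where 4: "0 < m\<^sub>4" "0 < M\<^sub>4"
    "\<And>p. p \<in> J \<Longrightarrow> m\<^sub>4 \<le> sigma_est (fst p) (snd p) \<and> sigma_est (fst p) (snd p) \<le> M\<^sub>4"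
    by (rule compact_positive_bounds[OF assms(3)]) (auto intro: sigma_est_pos J_pos)
  define S where "S = max M\<^sub>1 M\<^sub>4"
  define m where "m = min (min m\<^sub>2 (m\<^sub>2\<^sup>2 / 4)) m\<^sub>3"
  have "0 < S" "0 < m"
    using 1 2 3 by (auto simp: S_def m_def)
  show ?thesis
  proof (intro exI[of _ "S * (1 / 2 + 1 / (4 * m)) + 4 / m"] conjI allI impI)
    show "0 < S * (1 / 2 + 1 / (4 * m)) + 4 / m"
      using \<open>0 < S\<close> \<open>0 < m\<close> by (intro add_pos_pos mult_pos_pos) auto
    fix \<sigma> l A B
    assume *: "(\<sigma>, l) \<in> I \<and> (A, B) \<in> J"
    then have "m\<^sub>2 \<le> l"
      using 2(3)[of "(\<sigma>, l)"] by simp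
    then have "m\<^sub>2\<^sup>2 / 4 \<le> B_true l"
      using 2(1) by (simp add: B_true_def)
    then show "\<bar>sigma_est A B - \<sigma>\<bar> + \<bar>l_est B - l\<bar>
      \<le> (S * (1 / 2 + 1 / (4 * m)) + 4 / m) * (\<bar>A - A_true \<sigma> l\<bar> + \<bar>B - B_true l\<bar>)"
      using * \<open>m\<^sub>2 \<le> l\<close> \<open>0 < m\<close> 1(3)[of "(\<sigma>, l)"] 3(3)[of "(A, B)"] 4(3)[of "(A, B)"]
        I_pos[of "(\<sigma>, l)"]
      by (intro parameter_map_estimate) (auto simp: S_def m_def)
  qed
qed

section \<open>The parameter estimate\<close>

lemma log_fit_estimate:
  assumes "1 \<le> K" "0 < \<sigma>" "0 < l" "0 < c\<^sub>0"
    and lower: "\<And>j. j \<le> K \<Longrightarrow> c\<^sub>0 \<le> lambda_mod \<sigma> l j"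
    and error: "\<And>j. j \<le> K \<Longrightarrow> \<bar>\<nu> j - lambda_mod \<sigma> l j\<bar> \<le> E"
    and "E \<le> c\<^sub>0 / 2"
    and min: "is_arg_min (lsq K (\<lambda>j. ln (\<nu> j))) (\<lambda>_. True) (A, B)"
  shows "\<bar>A - A_true \<sigma> l\<bar> + \<bar>B - B_true l\<bar> \<le> 6 * (1 + sqrt (real K + 1)) / c\<^sub>0 * E"
proof -
  have "\<bar>ln (\<nu> j) - (A_true \<sigma> l - B_true l * node j)\<bar> \<le> E / (c\<^sub>0 / 2)" if "j \<le> K" for j
  proof -
    have "\<bar>ln (\<nu> j) - ln (lambda_mod \<sigma> l j)\<bar> \<le> \<bar>\<nu> j - lambda_mod \<sigma> l j\<bar> / (c\<^sub>0 / 2)"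
      using lower[OF that] error[OF that] \<open>E \<le> c\<^sub>0 / 2\<close> \<open>0 < c\<^sub>0\<close>
      by (intro abs_ln_diff_le) linarith+
    also have "\<dots> \<le> E / (c\<^sub>0 / 2)"
      using error[OF that] \<open>0 < c\<^sub>0\<close> by (intro divide_right_mono) auto
    finally show ?thesis
      using assms by (simp add: ln_lambda_mod)
  qed
  from lsq_minimiser_stable[OF \<open>1 \<le> K\<close> this min] show ?thesis
    by (simp add: algebra_simps add_divide_distrib)
qed

theorem theorem4p2:
  "\<exists>(C1 :: nat \<Rightarrow> real \<Rightarrow> real) (C2 :: (real \<times> real) set \<Rightarrow> (real \<times> real) set \<Rightarrow> real).
    (\<forall>K c0. 2 \<le> K \<and> 0 < c0 \<longrightarrow> 0 < C1 K c0) \<and>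
    (\<forall>I IAB. compact I \<and> I \<subseteq> {0<..} \<times> {0<..} \<and> compact IAB \<and> IAB \<subseteq> UNIV \<times> {0<..} \<longrightarrow> 0 < C2 I IAB) \<and>
    (\<forall>(N::nat) (n::nat) (K::nat) (\<sigma>::real) (l::real)
       (x :: nat \<Rightarrow> real vec) (xrec :: nat \<Rightarrow> real vec)
       (\<mu> :: nat \<Rightarrow> real) (\<mu>rec :: nat \<Rightarrow> real) (lam :: nat \<Rightarrow> real) (lamrec :: nat \<Rightarrow> real)
       (M::real) (\<epsilon>::real) (Emod::real) (E::real) (c0::real) (Afit::real) (Bfit::real).
      2 \<le> N \<and> 2 \<le> K \<and> K \<le> n - 1 \<and> 0 < \<sigma> \<and> 0 < l \<and>
      (\<forall>s\<in>{1..N}. x s \<in> carrier_vec n \<and> xrec s \<in> carrier_vec n) \<and>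
      enumerates_eigenvalues (emp_cov N n x) \<mu> \<and>
      enumerates_eigenvalues (emp_cov N n xrec) \<mu>rec \<and>
      corresponding n \<mu> \<mu>rec \<and>
      lam = (\<lambda>j. quad_weight n * \<mu> j) \<and>
      lamrec = (\<lambda>j. quad_weight n * \<mu>rec j) \<and>
      0 < Emod \<and> (\<forall>j\<le>K. \<bar>lam j - lambda_mod \<sigma> l j\<bar> \<le> Emod) \<and>
      E = E_eig N n M \<epsilon> + Emod \<and>
      0 < M \<and> 0 < \<epsilon> \<and>
      (\<Sum>s=1..N. x s \<bullet> x s) / real N \<le> M \<and>
      (\<Sum>s=1..N. (xrec s - x s) \<bullet> (xrec s - x s)) / real N \<le> \<epsilon>\<^sup>2 \<and>
      0 < c0 \<and> (\<forall>j\<le>K. c0 \<le> lambda_mod \<sigma> l j) \<and>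
      (\<forall>j\<le>K. \<bar>lamrec j - lambda_mod \<sigma> l j\<bar> \<le> E) \<and>
      E \<le> c0 / 2 \<and>
      is_arg_min (lsq K (\<lambda>j. ln (lamrec j))) (\<lambda>_. True) (Afit, Bfit)
      \<longrightarrow>
      \<bar>Afit - A_true \<sigma> l\<bar> + \<bar>Bfit - B_true l\<bar> \<le> C1 K c0 * E \<and>
      (\<forall>I IAB. compact I \<and> I \<subseteq> {0<..} \<times> {0<..} \<and> (\<sigma>, l) \<in> I \<and>
               compact IAB \<and> IAB \<subseteq> UNIV \<times> {0<..} \<and> (Afit, Bfit) \<in> IAB \<longrightarrow>
        \<bar>sigma_est Afit Bfit - \<sigma>\<bar> + \<bar>l_est Bfit - l\<bar>
          \<le> C2 I IAB * (\<bar>Afit - A_true \<sigma> l\<bar> + \<bar>Bfit - B_true l\<bar>) \<and>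
        C2 I IAB * (\<bar>Afit - A_true \<sigma> l\<bar> + \<bar>Bfit - B_true l\<bar>) \<le> C1 K c0 * C2 I IAB * E))"
proof -
  define C1 :: "nat \<Rightarrow> real \<Rightarrow> real" where "C1 = (\<lambda>K c0. 6 * (1 + sqrt (real K + 1)) / c0)"
  have C1_pos: "0 < C1 K c0" if "0 < c0" for K c0
    unfolding C1_def using that by (intro divide_pos_pos mult_pos_pos add_pos_nonneg) auto
  define lip where "lip = (\<lambda>I J C. \<forall>\<sigma> l A B. (\<sigma>, l) \<in> I \<and> (A, B) \<in> J \<longrightarrow>
    \<bar>sigma_est A B - \<sigma>\<bar> + \<bar>l_est B - l\<bar> \<le> C * (\<bar>A - A_true \<sigma> l\<bar> + \<bar>B - B_true l\<bar>))"
  define C2 :: "(real \<times> real) set \<Rightarrow> (real \<times> real) set \<Rightarrow> real"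
    where "C2 = (\<lambda>I J. SOME C. 0 < C \<and> lip I J C)"
  have C2: "0 < C2 I J \<and> lip I J (C2 I J)"
    if "compact I" "I \<subseteq> {0<..} \<times> {0<..}" "compact J" "J \<subseteq> UNIV \<times> {0<..}" for I J
    unfolding C2_def lip_def by (rule someI_ex) (rule parameter_map_lipschitz[OF that])
  have scaled: "c * d \<le> C * c * e" if "d \<le> C * e" "0 < c" for c C d e :: real
    using mult_left_mono[OF that(1), of c] that(2) by (simp add: mult_ac)
  show ?thesis
  proof (rule exI[of _ C1], rule exI[of _ C2], intro conjI, goal_cases)
    case 1
    then show ?case
      using C1_pos by blast
  next
    case 2
    then show ?case
      using C2 by blast
  next
    case 3
    show ?case
    proof (intro allI impI, elim conjE, goal_cases)
      case (1 N n K \<sigma> l x xrec \<mu> \<mu>rec lam lamrec M \<epsilon> Emod E c0 Afit Bfit)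
      have fit: "\<bar>Afit - A_true \<sigma> l\<bar> + \<bar>Bfit - B_true l\<bar> \<le> C1 K c0 * E"
        unfolding C1_def
      proof (rule log_fit_estimate[where \<nu> = lamrec])
        show "1 \<le> K"
          using \<open>2 \<le> K\<close> by simp
        show "c0 \<le> lambda_mod \<sigma> l j" if "j \<le> K" for j
          using \<open>\<forall>j\<le>K. c0 \<le> lambda_mod \<sigma> l j\<close> that by blast
        show "\<bar>lamrec j - lambda_mod \<sigma> l j\<bar> \<le> E" if "j \<le> K" for j
          using \<open>\<forall>j\<le>K. \<bar>lamrec j - lambda_mod \<sigma> l j\<bar> \<le> E\<close> that by blast
      qed fact+
      show ?case
      proof (intro conjI allI impI; (elim conjE)?)
        show "\<bar>Afit - A_true \<sigma> l\<bar> + \<bar>Bfit - B_true l\<bar> \<le> C1 K c0 * E"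
          by (fact fit)
        fix I J :: "(real \<times> real) set"
        assume sets: "compact I" "I \<subseteq> {0<..} \<times> {0<..}" "compact J" "J \<subseteq> UNIV \<times> {0<..}"
          and mem: "(\<sigma>, l) \<in> I" "(Afit, Bfit) \<in> J"
        show "\<bar>sigma_est Afit Bfit - \<sigma>\<bar> + \<bar>l_est Bfit - l\<bar>
            \<le> C2 I J * (\<bar>Afit - A_true \<sigma> l\<bar> + \<bar>Bfit - B_true l\<bar>)"
          using C2[OF sets] mem unfolding lip_def by blast
        show "C2 I J * (\<bar>Afit - A_true \<sigma> l\<bar> + \<bar>Bfit - B_true l\<bar>) \<le> C1 K c0 * C2 I J * E"
          using scaled[OF fit] C2[OF sets] by blast
      qed
    qed
  qed
qed

end
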